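(* Let $I\subseteq S$ be a proper monomial ideal and let $\mathbf a\succeq\mathbf a_I$. Then $$(\mathfrak m^{\mathbf a+\mathbf 1}: I^{\mathbf a}) = I+\mathfrak m^{\mathbf a+\mathbf 1}.$$
   Context: $k$ is a field, $n\ge 2$, $S=k[x_1,\ldots,x_n]$, $x^{\mathbf a}=x_1^{a_1}\cdots x_n^{a_n}$, $\preceq$ is the coordinatewise partial order on $\mathbb Z^n$, and $\mathbf 1=(1,\ldots,1)$. For $\mathbf b\in\mathbb N^n$ put $\mathfrak m^{\mathbf b}=\langle x_i^{b_i}\mid b_i\ge 1\rangle$; these are exactly the irreducible monomial ideals. $\mathbf a_I$ is the exponent vector of the least common multiple of the minimal generators of $I$, and $\mathrm{Irr}(I)$ is the set of irreducible components in the unique irredundant decomposition of $I$ as an intersection of irreducible monomial ideals; $\mathfrak m^{\mathbf b}\in\mathrm{Irr}(I)$ implies $\mathbf b\preceq\mathbf a_I$. For $\mathbf 0\preceq\mathbf b\preceq\mathbf a$ let $\mathbf b^{\mathbf a}$ be the vector with $i$th coordinate $a_i+1-b_i$ if $b_i\ge1$ and $0$ if $b_i=0$. For $\mathbf a\succeq\mathbf a_I$ the Alexander dual ideal of $I$ with respect to $\mathbf a$ is $I^{\mathbf a}=\langle x^{\mathbf b^{\mathbf a}}\mid \mathfrak m^{\mathbf b}\in\mathrm{Irr}(I)\rangle$. For ideals $A,B$ of $S$, $(A:B)=\{f\in S\mid fB\subseteq A\}$. *)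

theory Defs
  imports
    "HOL-Analysis.Finite_Cartesian_Product"
    "HOL-Library.Poly_Mapping"
    "HOL-Library.Set_Algebras"
begin

text \<open>
  The polynomial ring over \<open>'k\<close> in variables indexed by the finite type \<open>'n\<close> is the type of
  finitely supported functions from exponent vectors in \<open>nat ^ 'n\<close> to \<open>'k\<close>, with the
  convolution product. On \<open>nat ^ 'n\<close> the order \<open>\<le>\<close> is coordinatewise and \<open>1\<close> is the vector
  with all entries \<open>1\<close>.
\<close>

type_synonym ('n, 'k) mpoly = "(nat ^ 'n) \<Rightarrow>\<^sub>0 'k"

abbreviation is_ideal :: "'r::comm_ring_1 set \<Rightarrow> bool" where
  "is_ideal \<equiv> module.subspace (*)"

abbreviation ideal_gen :: "'r::comm_ring_1 set \<Rightarrow> 'r set" where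
  "ideal_gen \<equiv> module.span (*)"

definition colon :: "'r::comm_ring_1 set \<Rightarrow> 'r set \<Rightarrow> 'r set" where
  "colon A B = {f. \<forall>g\<in>B. f * g \<in> A}"

definition irreducible_ideal :: "'r::comm_ring_1 set \<Rightarrow> bool" where
  "irreducible_ideal Q \<longleftrightarrow> is_ideal Q \<and> Q \<noteq> UNIV \<and>
     (\<forall>J K. is_ideal J \<longrightarrow> is_ideal K \<longrightarrow> Q = J \<inter> K \<longrightarrow> Q = J \<or> Q = K)"

definition xpow :: "nat ^ 'n::finite \<Rightarrow> ('n, 'k::field) mpoly" where
  "xpow b = Poly_Mapping.single b 1"

definition monomial_ideal :: "('n::finite, 'k::field) mpoly set \<Rightarrow> bool" where
  "monomial_ideal I \<longleftrightarrow> (\<exists>G. I = ideal_gen (xpow ` G))"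

text \<open>Exponent vectors of the minimal generators: the unique minimal set of monomials
  generating the monomial ideal \<open>I\<close>.\<close>

definition min_gens :: "('n::finite, 'k::field) mpoly set \<Rightarrow> (nat ^ 'n) set" where
  "min_gens I = (THE G. ideal_gen (xpow ` G) = I \<and> (\<forall>H. H \<subset> G \<longrightarrow> ideal_gen (xpow ` H) \<noteq> I))"

text \<open>By Dickson's lemma the supremum is that of a finite set of naturals. It is \<open>0\<close> for the
  empty set, so the zero ideal has lcm exponent \<open>0\<close>.\<close>

definition lcm_exp :: "('n::finite, 'k::field) mpoly set \<Rightarrow> nat ^ 'n" where
  "lcm_exp I = (\<chi> i. SUP c\<in>min_gens I. c $ i)"

definition m_pow :: "nat ^ 'n::finite \<Rightarrow> ('n, 'k::field) mpoly set" where
  "m_pow b = ideal_gen {xpow (axis i (b $ i)) | i. b $ i \<ge> 1}"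

definition irredundant_decomp ::
    "('n::finite, 'k::field) mpoly set set \<Rightarrow> ('n, 'k) mpoly set \<Rightarrow> bool" where
  "irredundant_decomp D I \<longleftrightarrow>
     finite D \<and> (\<forall>Q\<in>D. monomial_ideal Q \<and> irreducible_ideal Q) \<and>
     \<Inter>D = I \<and> (\<forall>Q\<in>D. \<Inter>(D - {Q}) \<noteq> I)"

definition Irr :: "('n::finite, 'k::field) mpoly set \<Rightarrow> ('n, 'k) mpoly set set" where
  "Irr I = (THE D. irredundant_decomp D I)"

text \<open>Only used for \<open>b \<le> a\<close>, where the subtraction of naturals does not truncate.\<close>

definition dual_exp :: "nat ^ 'n::finite \<Rightarrow> nat ^ 'n \<Rightarrow> nat ^ 'n" where
  "dual_exp a b = (\<chi> i. if b $ i \<ge> 1 then a $ i + 1 - b $ i else 0)"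

definition alexander_dual ::
    "nat ^ 'n::finite \<Rightarrow> ('n, 'k::field) mpoly set \<Rightarrow> ('n, 'k) mpoly set" where
  "alexander_dual a I = ideal_gen {xpow (dual_exp a b) | b. m_pow b \<in> Irr I}"

end

theory Submission
  imports Defs
begin

text \<open>
  A monomial ideal consists of the polynomials whose exponent vectors all lie in a fixed upper set
  of \<open>\<nat>\<^sup>n\<close>, and sums and intersections of such ideals are unions and intersections of upper sets.
  The colon ideal by a monomial ideal is tested on the generating monomials, and multiplication by a
  monomial only shifts the exponents. So everything is decided one exponent vector \<open>c\<close> at a time:
  \<open>x\<^sup>c\<close> lies in the colon ideal iff for every component \<open>m_pow b\<close> of \<open>I\<close> some
  coordinate satisfies \<open>c\<^sub>i + dual_exp a b\<^sub>i \<ge> a\<^sub>i + 1\<close>. Because \<open>b \<le> a\<close>, this inequality says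
  \<open>c\<^sub>i \<ge> b\<^sub>i\<close> when \<open>b\<^sub>i \<ge> 1\<close> and \<open>c\<^sub>i \<ge> a\<^sub>i + 1\<close> when \<open>b\<^sub>i = 0\<close>, so the condition is that
  \<open>x\<^sup>c\<close> lies in \<open>m_pow b\<close> or in \<open>m_pow (a + 1)\<close> (\<open>add_dual_exp_in_pow_up_iff\<close>).
  Taking all components together gives \<open>I + m_pow (a + 1)\<close>.

  This uses that \<open>Irr I\<close> intersects to \<open>I\<close> and consists of ideals \<open>m_pow b\<close> with
  \<open>b \<le> lcm_exp I\<close> (\<open>Irr_m_pow\<close>), which is where most of the work lies. The ideals
  \<open>m_pow b\<close> that contain \<open>I\<close> and have \<open>b \<le> lcm_exp I\<close> are finitely many and already
  intersect to \<open>I\<close> (\<open>Inter_m_pow_above\<close>), so some subfamily is irredundant. It is a decomposition in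
  the required sense because every \<open>m_pow b\<close> is irreducible among all ideals, not just among
  monomial ones (\<open>irreducible_m_pow\<close>). It is the only one because the lattice of monomial ideals is
  distributive: an irreducible monomial ideal that contains a finite intersection of monomial ideals
  contains one of them (\<open>irreducible_contains_component\<close>). Finally, \<open>lcm_exp I\<close> is a supremum of
  finitely many exponents by Dickson's lemma (\<open>dickson\<close>), so it really bounds the minimal generators.
\<close>

text \<open>Ideals of a ring are its submodules as a module over itself; this makes the theory of spans
  available for them.\<close>

interpretation ideals: module "(*) :: 'r::comm_ring_1 \<Rightarrow> 'r \<Rightarrow> 'r"
  by unfold_locales (simp_all add: algebra_simps)

(* As a simplification rule, this reversed associativity would loop with mult_ac. *)
declare ideals.scale_scale [simp del]

section \<open>Monomials, supports and products\<close>

abbreviation "lookup \<equiv> Poly_Mapping.lookup"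
abbreviation "keys \<equiv> Poly_Mapping.keys"

lemma sum_single_keys: "(\<Sum>c\<in>keys f. Poly_Mapping.single c (lookup f c)) = f"
  by (rule poly_mapping_eqI)
     (simp add: lookup_sum lookup_single when_def not_in_keys_iff_lookup_eq_zero)

lemma keys_sum_subset: "keys (sum F A) \<subseteq> (\<Union>x\<in>A. keys (F x))"
proof (induction A rule: infinite_finite_induct)
  case (insert x A)
  then show ?case using keys_add[of "F x" "sum F A"] by auto
qed auto

text \<open>If \<open>a + b\<close> arises in only one way as a sum of exponents of \<open>f\<close> and \<open>g\<close>, no cancellation can
  occur in that coefficient of the product. Both multiplication by a monomial and the absence of zero
  divisors come from this.\<close>

lemma lookup_mult_unique:
  fixes f g :: "'a::monoid_add \<Rightarrow>\<^sub>0 'k::comm_semiring_1"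
  assumes uniq: "\<And>x y. x \<in> keys f \<Longrightarrow> y \<in> keys g \<Longrightarrow> x + y = a + b \<Longrightarrow> x = a \<and> y = b"
  shows "lookup (f * g) (a + b) = lookup f a * lookup g b"
proof -
  have "f * g = (\<Sum>x\<in>keys f. \<Sum>y\<in>keys g. Poly_Mapping.single (x + y) (lookup f x * lookup g y))"
    by (subst sum_single_keys[of f, symmetric], subst sum_single_keys[of g, symmetric])
       (simp only: sum_product mult_single)
  then have "lookup (f * g) (a + b)
      = (\<Sum>x\<in>keys f. \<Sum>y\<in>keys g. if x + y = a + b then lookup f x * lookup g y else 0)"
    by (simp add: lookup_sum lookup_single when_def)
  also have "\<dots> = (\<Sum>x\<in>keys f. \<Sum>y\<in>keys g.
      if y = b then (if x = a then lookup f a * lookup g b else 0) else 0)"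
    by (intro sum.cong refl) (use uniq in auto)
  also have "\<dots> = lookup f a * lookup g b"
    by (cases "b \<in> keys g") (auto simp: in_keys_iff)
  finally show ?thesis .
qed

lemma keys_xpow [simp]: "keys (xpow b) = {b}"
  by (simp add: xpow_def)

lemma lookup_xpow_self [simp]: "lookup (xpow b) b = 1"
  by (simp add: xpow_def)

lemma lookup_mult_xpow: "lookup (f * xpow d) (c + d) = lookup f c"
  by (subst lookup_mult_unique) auto

lemma keys_mult_xpow: "keys (f * xpow d) = (\<lambda>c. c + d) ` keys f"
proof -
  have "keys (f * xpow d) \<subseteq> (\<lambda>c. c + d) ` keys f"
    using keys_mult[of f "xpow d"] by auto
  moreover have "c + d \<in> keys (f * xpow d)" if "c \<in> keys f" for c
    using that by (simp add: in_keys_iff lookup_mult_xpow)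
  ultimately show ?thesis by auto
qed

text \<open>The extreme points of \<open>A\<close> and \<open>B\<close> in a lexicographic order form such a pair. No order on the
  coordinates has to be fixed: cutting \<open>A\<close> and \<open>B\<close> down to the points with maximal \<open>j\<close>-th
  coordinate, for one \<open>j\<close> after another, keeps the property that sums of the remaining points arise
  only from remaining points, and in the end one point of each set is left.\<close>

lemma unique_sum_pair:
  fixes A B :: "(nat ^ 'n::finite) set"
  assumes "finite A" "finite B" "A \<noteq> {}" "B \<noteq> {}"
  obtains a b where "a \<in> A" "b \<in> B"
    "\<And>x y. x \<in> A \<Longrightarrow> y \<in> B \<Longrightarrow> x + y = a + b \<Longrightarrow> x = a \<and> y = b"
proof -
  have "\<exists>A' B'. A' \<subseteq> A \<and> B' \<subseteq> B \<and> A' \<noteq> {} \<and> B' \<noteq> {} \<and>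
      (\<forall>x\<in>A'. \<forall>y\<in>A'. \<forall>i\<in>F. x $ i = y $ i) \<and> (\<forall>x\<in>B'. \<forall>y\<in>B'. \<forall>i\<in>F. x $ i = y $ i) \<and>
      (\<forall>a\<in>A'. \<forall>b\<in>B'. \<forall>x\<in>A. \<forall>y\<in>B. x + y = a + b \<longrightarrow> x \<in> A' \<and> y \<in> B')"
    if "finite F" for F :: "'n set"
    using that
  proof (induction F rule: finite_induct)
    case empty
    show ?case using assms by (intro exI[of _ A] exI[of _ B]) auto
  next
    case (insert j F)
    then obtain A' B' where A': "A' \<subseteq> A" "A' \<noteq> {}" "\<forall>x\<in>A'. \<forall>y\<in>A'. \<forall>i\<in>F. x $ i = y $ i"
      and B': "B' \<subseteq> B" "B' \<noteq> {}" "\<forall>x\<in>B'. \<forall>y\<in>B'. \<forall>i\<in>F. x $ i = y $ i"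
      and closed: "\<forall>a\<in>A'. \<forall>b\<in>B'. \<forall>x\<in>A. \<forall>y\<in>B. x + y = a + b \<longrightarrow> x \<in> A' \<and> y \<in> B'"
      by blast
    have fin: "finite ((\<lambda>x. x $ j) ` A')" "finite ((\<lambda>x. x $ j) ` B')"
      using A'(1) B'(1) assms(1,2) by (auto intro: finite_subset)
    define m where "m = Max ((\<lambda>x. x $ j) ` A')"
    define n where "n = Max ((\<lambda>x. x $ j) ` B')"
    have m_max: "x $ j \<le> m" if "x \<in> A'" for x using that fin by (simp add: m_def)
    have n_max: "x $ j \<le> n" if "x \<in> B'" for x using that fin by (simp add: n_def)
    have m_in: "m \<in> (\<lambda>x. x $ j) ` A'" unfolding m_def using fin A'(2) by (intro Max_in) auto
    have n_in: "n \<in> (\<lambda>x. x $ j) ` B'" unfolding n_def using fin B'(2) by (intro Max_in) auto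
    have key: "x \<in> A' \<and> x $ j = m \<and> y \<in> B' \<and> y $ j = n"
      if "a \<in> A'" "a $ j = m" "b \<in> B'" "b $ j = n" "x \<in> A" "y \<in> B" and eq: "x + y = a + b"
      for a b x y
    proof -
      have xy: "x \<in> A'" "y \<in> B'" using closed that by blast+
      have "x $ j + y $ j = m + n" using eq that by (metis vector_add_component)
      then show ?thesis using m_max[OF xy(1)] n_max[OF xy(2)] xy by auto
    qed
    let ?A = "{x \<in> A'. x $ j = m}" and ?B = "{x \<in> B'. x $ j = n}"
    have "?A \<subseteq> A" "?B \<subseteq> B" "?A \<noteq> {}" "?B \<noteq> {}"
      using A'(1) B'(1) m_in n_in by auto
    moreover have "\<forall>x\<in>?A. \<forall>y\<in>?A. \<forall>i\<in>insert j F. x $ i = y $ i"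
      "\<forall>x\<in>?B. \<forall>y\<in>?B. \<forall>i\<in>insert j F. x $ i = y $ i"
      using A'(3) B'(3) by simp_all
    moreover have "\<forall>a\<in>?A. \<forall>b\<in>?B. \<forall>x\<in>A. \<forall>y\<in>B. x + y = a + b \<longrightarrow> x \<in> ?A \<and> y \<in> ?B"
      using key by blast
    ultimately show ?case by (intro exI[of _ ?A] exI[of _ ?B] conjI)
  qed
  from this[OF finite, of UNIV] obtain A' B' where sub: "A' \<subseteq> A" "B' \<subseteq> B" "A' \<noteq> {}" "B' \<noteq> {}"
    and single: "\<forall>x\<in>A'. \<forall>y\<in>A'. \<forall>i. x $ i = y $ i" "\<forall>x\<in>B'. \<forall>y\<in>B'. \<forall>i. x $ i = y $ i"
    and closed: "\<forall>a\<in>A'. \<forall>b\<in>B'. \<forall>x\<in>A. \<forall>y\<in>B. x + y = a + b \<longrightarrow> x \<in> A' \<and> y \<in> B'"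
    unfolding ball_UNIV by blast
  obtain a b where ab: "a \<in> A'" "b \<in> B'" using sub by blast
  have "x = a \<and> y = b" if "x \<in> A" "y \<in> B" "x + y = a + b" for x y
  proof -
    have "x \<in> A'" "y \<in> B'" using closed ab that by blast+
    then show ?thesis using single ab unfolding vec_eq_iff by blast
  qed
  with ab sub show thesis by (intro that[of a b]) auto
qed

text \<open>Exponent vectors are only partially ordered, so there are no canonical leading terms to multiply;
  a pair of exponents whose sum arises only once replaces them.\<close>

lemma mpoly_mult_nonzero:
  fixes p q :: "('n::finite, 'k::field) mpoly"
  assumes "p \<noteq> 0" "q \<noteq> 0"
  shows "p * q \<noteq> 0"
proof -
  obtain a b where ab: "a \<in> keys p" "b \<in> keys q"
    "\<And>x y. x \<in> keys p \<Longrightarrow> y \<in> keys q \<Longrightarrow> x + y = a + b \<Longrightarrow> x = a \<and> y = b"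
    using unique_sum_pair[of "keys p" "keys q"] assms by auto
  have "lookup (p * q) (a + b) = lookup p a * lookup q b"
    using ab(3) by (rule lookup_mult_unique)
  then have "lookup (p * q) (a + b) \<noteq> 0"
    using ab(1,2) by (simp add: in_keys_iff)
  then show ?thesis by auto
qed


section \<open>Monomial ideals as upper sets of exponents\<close>

definition supported_on :: "(nat ^ 'n::finite) set \<Rightarrow> ('n, 'k::field) mpoly set" where
  "supported_on U = {f. keys f \<subseteq> U}"

definition up_closed :: "(nat ^ 'n::finite) set \<Rightarrow> bool" where
  "up_closed U \<longleftrightarrow> (\<forall>c\<in>U. \<forall>d\<ge>c. d \<in> U)"

definition up :: "(nat ^ 'n::finite) set \<Rightarrow> (nat ^ 'n) set" where
  "up G = {c. \<exists>g\<in>G. g \<le> c}"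

lemma up_closedD: "up_closed U \<Longrightarrow> c \<in> U \<Longrightarrow> c \<le> d \<Longrightarrow> d \<in> U"
  by (auto simp: up_closed_def)

lemma up_closed_up: "up_closed (up G)"
  by (auto simp: up_closed_def up_def intro: order_trans)

lemma up_of_up_closed: "up_closed U \<Longrightarrow> up U = U"
  by (auto simp: up_closed_def up_def)

lemma up_closed_Un: "up_closed U \<Longrightarrow> up_closed V \<Longrightarrow> up_closed (U \<union> V)"
  by (auto simp: up_closed_def)

lemma up_closed_Inter: "(\<And>U. U \<in> \<F> \<Longrightarrow> up_closed U) \<Longrightarrow> up_closed (\<Inter>\<F>)"
  by (auto simp: up_closed_def)

lemma xpow_in_supported_on [simp]: "xpow c \<in> supported_on U \<longleftrightarrow> c \<in> U"
  by (simp add: supported_on_def)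

lemma supported_on_subset_iff [simp]:
  "(supported_on U :: ('n::finite, 'k::field) mpoly set) \<subseteq> supported_on V \<longleftrightarrow> U \<subseteq> V"
proof
  assume "(supported_on U :: ('n, 'k) mpoly set) \<subseteq> supported_on V"
  then have "(xpow c :: ('n, 'k) mpoly) \<in> supported_on V" if "c \<in> U" for c
    using that by (meson xpow_in_supported_on subsetD)
  then show "U \<subseteq> V" by auto
qed (auto simp: supported_on_def)

lemma supported_on_eq_iff [simp]:
  "(supported_on U :: ('n::finite, 'k::field) mpoly set) = supported_on V \<longleftrightarrow> U = V"
  by (simp add: set_eq_subset)

lemma supported_on_Int: "supported_on (U \<inter> V) = supported_on U \<inter> supported_on V"
  by (auto simp: supported_on_def)

lemma supported_on_Inter: "supported_on (\<Inter>\<F>) = \<Inter>(supported_on ` \<F>)"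
  by (auto simp: supported_on_def)

lemma is_ideal_supported_on:
  fixes U :: "(nat ^ 'n::finite) set"
  assumes "up_closed U"
  shows "is_ideal (supported_on U :: ('n, 'k::field) mpoly set)"
proof (rule ideals.subspaceI)
  fix f g :: "('n, 'k) mpoly"
  assume fg: "g \<in> supported_on U"
  have "c \<in> U" if c: "c \<in> keys (f * g)" for c
  proof -
    obtain x y where "c = x + y" "y \<in> keys g"
      using keys_mult[of f g] c by blast
    then show ?thesis
      using fg assms by (auto simp: supported_on_def up_closed_def less_eq_vec_def)
  qed
  then show "f * g \<in> supported_on U" by (auto simp: supported_on_def)
qed (use keys_add in \<open>fastforce simp: supported_on_def\<close>)+

lemma ideal_gen_xpow:
  "ideal_gen (xpow ` G) = (supported_on (up G) :: ('n::finite, 'k::field) mpoly set)"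
proof
  show "ideal_gen (xpow ` G) \<subseteq> (supported_on (up G) :: ('n, 'k) mpoly set)"
    by (rule ideals.span_minimal[OF _ is_ideal_supported_on[OF up_closed_up]])
       (auto simp: up_def)
  show "(supported_on (up G) :: ('n, 'k) mpoly set) \<subseteq> ideal_gen (xpow ` G)"
  proof
    fix f :: "('n, 'k) mpoly"
    assume f: "f \<in> supported_on (up G)"
    have "Poly_Mapping.single c (lookup f c) \<in> ideal_gen (xpow ` G)" if c: "c \<in> keys f" for c
    proof -
      obtain g where g: "g \<in> G" "g \<le> c" using f c by (auto simp: supported_on_def up_def)
      then have "c = (c - g) + g" by (auto simp: vec_eq_iff less_eq_vec_def)
      then have "Poly_Mapping.single c (lookup f c)
          = Poly_Mapping.single (c - g) (lookup f c) * xpow g"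
        by (simp add: xpow_def mult_single)
      then show ?thesis using g(1) by (simp add: ideals.span_scale ideals.span_base)
    qed
    then show "f \<in> ideal_gen (xpow ` G)"
      by (subst sum_single_keys[of f, symmetric]) (rule ideals.span_sum)
  qed
qed

lemma supported_on_eq_ideal_gen: "up_closed U \<Longrightarrow> supported_on U = ideal_gen (xpow ` U)"
  by (simp add: ideal_gen_xpow up_of_up_closed)

lemma supported_on_Un:
  assumes "up_closed U" "up_closed V"
  shows "supported_on (U \<union> V) = supported_on U + supported_on V"
proof -
  have "supported_on (U \<union> V) = ideal_gen (xpow ` U \<union> xpow ` V)"
    by (simp only: supported_on_eq_ideal_gen[OF up_closed_Un[OF assms]] image_Un)
  also have "\<dots> = ideal_gen (xpow ` U) + ideal_gen (xpow ` V)"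
    unfolding ideals.span_Un set_plus_def by blast
  also have "\<dots> = supported_on U + supported_on V"
    using assms by (simp only: supported_on_eq_ideal_gen)
  finally show ?thesis .
qed

lemma monomial_ideal_iff: "monomial_ideal I \<longleftrightarrow> (\<exists>U. up_closed U \<and> I = supported_on U)"
proof
  assume "monomial_ideal I"
  then obtain G where "I = ideal_gen (xpow ` G)" by (auto simp: monomial_ideal_def)
  then show "\<exists>U. up_closed U \<and> I = supported_on U"
    by (intro exI[of _ "up G"] conjI up_closed_up) (simp only: ideal_gen_xpow)
next
  assume "\<exists>U. up_closed U \<and> I = supported_on U"
  then obtain U where "up_closed U" "I = supported_on U" by blast
  then have "I = ideal_gen (xpow ` U)" by (simp only: supported_on_eq_ideal_gen)
  then show "monomial_ideal I" unfolding monomial_ideal_def by blast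
qed


section \<open>The ideals generated by pure powers\<close>

text \<open>The exponents of the monomials in \<open>m_pow b\<close>.\<close>

definition pow_up :: "nat ^ 'n::finite \<Rightarrow> (nat ^ 'n) set" where
  "pow_up b = {c. \<exists>i. 1 \<le> b $ i \<and> b $ i \<le> c $ i}"

lemma up_closed_pow_up: "up_closed (pow_up b)"
  by (auto simp: up_closed_def pow_up_def less_eq_vec_def intro: order_trans)

lemma less_if_notin_pow_up: "c \<notin> pow_up b \<Longrightarrow> 1 \<le> b $ i \<Longrightarrow> c $ i < b $ i"
  unfolding pow_up_def not_le[symmetric] by blast

lemma m_pow_eq: "m_pow b = (supported_on (pow_up b) :: ('n::finite, 'k::field) mpoly set)"
proof -
  have "{xpow (axis i (b $ i)) :: ('n, 'k) mpoly | i. b $ i \<ge> 1} = xpow ` {axis i (b $ i) | i. b $ i \<ge> 1}"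
    by auto
  moreover have "axis i k \<le> c \<longleftrightarrow> k \<le> c $ i" for i k and c :: "nat ^ 'n"
    by (auto simp: less_eq_vec_def axis_def)
  then have "up {axis i (b $ i) | i. b $ i \<ge> 1} = pow_up b"
    by (auto simp: up_def pow_up_def)
  ultimately show ?thesis unfolding m_pow_def by (simp only: ideal_gen_xpow)
qed

text \<open>The multiples of the \<open>i\<close>-th unit vector that lie in \<open>pow_up b\<close> determine \<open>b\<^sub>i\<close>: there are none
  iff \<open>b\<^sub>i\<close> is \<open>0\<close>, and otherwise \<open>b\<^sub>i\<close> is the least factor that occurs. Since \<open>alexander_dual\<close> ranges over all
  \<open>b\<close> with \<open>m_pow b\<close> in \<open>Irr I\<close>, this is what transfers the bound on one such \<open>b\<close> to all.\<close>

lemma pow_up_inject: 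
  assumes "pow_up b = pow_up b'"
  shows "b = b'"
proof -
  have "axis i k \<in> pow_up c \<longleftrightarrow> 1 \<le> c $ i \<and> c $ i \<le> k" for i k and c :: "nat ^ 'a"
    by (auto simp: pow_up_def axis_def split: if_splits)
  then have "1 \<le> b $ i \<and> b $ i \<le> k \<longleftrightarrow> 1 \<le> b' $ i \<and> b' $ i \<le> k" for i k
    using assms by metis
  then have "b $ i = b' $ i" for i
    by (metis le_antisym less_one not_le order_refl)
  then show ?thesis by (simp add: vec_eq_iff)
qed

lemma m_pow_inject: "m_pow b = m_pow b' \<longleftrightarrow> b = b'"
  by (auto simp: m_pow_eq dest: pow_up_inject)

text \<open>Modulo \<open>m_pow b\<close>, only exponents with \<open>c\<^sub>i < b\<^sub>i\<close> for all \<open>i\<close> with \<open>b\<^sub>i \<ge> 1\<close> survive. Among the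
  surviving exponents of an element of \<open>J\<close> outside \<open>m_pow b\<close>, one with the smallest sum
  of these coordinates can be moved to the corner \<open>b\<^sub>i - 1\<close> by a monomial; every exponent that differs
  from it in one of these coordinates is then pushed into \<open>m_pow b\<close>. What is left is the corner monomial times a
  nonzero polynomial in the variables with \<open>b\<^sub>i = 0\<close>: the socle of the quotient by \<open>m_pow b\<close>, relative
  to the free variables, meets every larger ideal.\<close>

lemma m_pow_corner:
  fixes J :: "('n::finite, 'k::field) mpoly set"
  assumes J: "is_ideal J" and sub: "m_pow b \<subseteq> J" and ne: "J \<noteq> m_pow b"
  obtains p where "p \<noteq> 0" "p * xpow (\<chi> i. b $ i - 1) \<in> J"
    "\<forall>c\<in>keys p. \<forall>i. 1 \<le> b $ i \<longrightarrow> c $ i = 0"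
proof -
  obtain f where f: "f \<in> J" "f \<notin> m_pow b" using sub ne by blast
  define B where "B = {i. 1 \<le> b $ i}"
  define w where "w c = (\<Sum>i\<in>B. c $ i)" for c :: "nat ^ 'n"
  define r :: "nat ^ 'n" where "r = (\<chi> i. b $ i - 1)"
  have "\<exists>c. c \<in> keys f - pow_up b"
    using f(2) by (auto simp: m_pow_eq supported_on_def)
  then obtain c where c: "c \<in> keys f" "c \<notin> pow_up b"
    and c_min: "\<And>d. d \<in> keys f - pow_up b \<Longrightarrow> w c \<le> w d"
    using ex_has_least_nat[of "\<lambda>c. c \<in> keys f - pow_up b" _ w] by blast
  \<comment> \<open>The monomial with exponent \<open>e\<close> moves \<open>c\<close> to the corner and leaves the free variables alone.\<close>
  define e :: "nat ^ 'n" where "e = (\<chi> i. if 1 \<le> b $ i then b $ i - 1 - c $ i else 0)"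
  define h where "h = f * xpow e"
  have h: "h \<in> J"
    using ideals.subspace_scale[OF J f(1), of "xpow e"] by (simp add: h_def mult.commute)
  have face: "k $ i = b $ i - 1" if k: "k \<in> keys h" "k \<notin> pow_up b" and i: "1 \<le> b $ i" for k i
  proof -
    obtain d where d: "d \<in> keys f" "k = d + e"
      using k(1) by (auto simp: h_def keys_mult_xpow)
    have "d \<le> k" using d(2) by (simp add: less_eq_vec_def)
    then have "d \<notin> pow_up b" using k(2) up_closedD[OF up_closed_pow_up] by blast
    then have le: "w c \<le> w d" using c_min d(1) by blast
    have d_le: "d $ j \<le> c $ j" if "j \<in> B" for j
    proof -
      have "1 \<le> b $ j" using that by (simp add: B_def)
      moreover from this have "k $ j < b $ j" "c $ j < b $ j"
        using k(2) c(2) by (simp_all add: less_if_notin_pow_up)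
      ultimately show ?thesis using d(2) by (simp add: e_def)
    qed
    have "i \<in> B" using i by (simp add: B_def)
    have "d $ i = c $ i"
    proof (rule ccontr)
      assume "d $ i \<noteq> c $ i"
      with \<open>i \<in> B\<close> d_le have "d $ i < c $ i" by (simp add: le_neq_implies_less)
      with \<open>i \<in> B\<close> have "w d < w c"
        unfolding w_def using d_le by (intro sum_strict_mono_ex1) auto
      with le show False by simp
    qed
    moreover have "c $ i < b $ i" using c(2) i by (rule less_if_notin_pow_up)
    ultimately show ?thesis using d(2) i by (simp add: e_def)
  qed
  \<comment> \<open>Divide the part of \<open>h\<close> outside \<open>m_pow b\<close> by the corner monomial.\<close>
  define p where "p = (\<Sum>k\<in>keys h - pow_up b. Poly_Mapping.single (k - r) (lookup h k))"
  have "p * xpow r = (\<Sum>k\<in>keys h - pow_up b. Poly_Mapping.single k (lookup h k))"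
    unfolding p_def sum_distrib_right
  proof (rule sum.cong[OF refl])
    fix k assume "k \<in> keys h - pow_up b"
    then have "r $ i \<le> k $ i" for i
      using face[of k i] by (cases "1 \<le> b $ i") (simp_all add: r_def)
    then have "k - r + r = k" by (simp add: vec_eq_iff)
    then show "Poly_Mapping.single (k - r) (lookup h k) * xpow r = Poly_Mapping.single k (lookup h k)"
      by (simp add: xpow_def mult_single)
  qed
  then have lookup_p: "lookup (p * xpow r) k = (if k \<in> pow_up b then 0 else lookup h k)" for k
    by (simp add: lookup_sum lookup_single when_def not_in_keys_iff_lookup_eq_zero)
  have p_J: "p * xpow r \<in> J"
  proof -
    have "h - p * xpow r \<in> m_pow b"
      by (auto simp: m_pow_eq supported_on_def in_keys_iff lookup_minus lookup_p split: if_splits)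
    then have "h - (h - p * xpow r) \<in> J"
      using sub by (blast intro: ideals.subspace_diff[OF J h])
    then show ?thesis by simp
  qed
  have p_nz: "p \<noteq> 0"
  proof
    assume "p = 0"
    then have "c + e \<in> pow_up b \<or> lookup h (c + e) = 0"
      using lookup_p[of "c + e"] by (auto split: if_splits)
    moreover have "lookup h (c + e) \<noteq> 0"
      using c(1) by (simp add: h_def lookup_mult_xpow in_keys_iff)
    moreover have "c + e \<notin> pow_up b"
      using c(2) by (auto simp: pow_up_def e_def)
    ultimately show False by blast
  qed
  have p_free: "d $ i = 0" if d: "d \<in> keys p" and i: "1 \<le> b $ i" for d i
  proof -
    have "keys p \<subseteq> (\<Union>k\<in>keys h - pow_up b. {k - r})"
      unfolding p_def by (rule order_trans[OF keys_sum_subset]) auto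
    then obtain k where "k \<in> keys h" "k \<notin> pow_up b" "d = k - r" using d by blast
    then show ?thesis using face i by (simp add: r_def)
  qed
  from p_free have "\<forall>c\<in>keys p. \<forall>i. 1 \<le> b $ i \<longrightarrow> c $ i = 0" by blast
  with p_nz p_J[unfolded r_def] show thesis by (rule that)
qed

text \<open>If \<open>J\<close> and \<open>K\<close> are both strictly larger, they contain corner elements \<open>p * x\<^sup>r\<close> and
  \<open>q * x\<^sup>r\<close> with \<open>p\<close> and \<open>q\<close> in the free variables only. Then \<open>p * q * x\<^sup>r\<close> lies in both ideals,
  and as \<open>p * q\<close> is nonzero it does not lie in \<open>m_pow b\<close>.\<close>

lemma irreducible_m_pow: "irreducible_ideal (m_pow b :: ('n::finite, 'k::field) mpoly set)"
  unfolding irreducible_ideal_def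
proof (intro conjI allI impI)
  show "is_ideal (m_pow b)"
    by (simp add: m_pow_eq is_ideal_supported_on up_closed_pow_up)
  have "0 \<notin> pow_up b" by (auto simp: pow_up_def)
  then have "(xpow 0 :: ('n, 'k) mpoly) \<notin> m_pow b" by (simp add: m_pow_eq)
  then show "m_pow b \<noteq> (UNIV :: ('n, 'k) mpoly set)" by blast
  fix J K :: "('n, 'k) mpoly set"
  assume J: "is_ideal J" and K: "is_ideal K" and JK: "m_pow b = J \<inter> K"
  show "m_pow b = J \<or> m_pow b = K"
  proof (rule ccontr)
    assume "\<not> ?thesis"
    then have ne: "J \<noteq> m_pow b" "K \<noteq> m_pow b" by auto
    have sub: "m_pow b \<subseteq> J" "m_pow b \<subseteq> K" using JK by auto
    define r :: "nat ^ 'n" where "r = (\<chi> i. b $ i - 1)"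
    obtain p where p: "p \<noteq> 0" "p * xpow r \<in> J"
      "\<forall>c\<in>keys p. \<forall>i. 1 \<le> b $ i \<longrightarrow> c $ i = 0"
      by (rule m_pow_corner[OF J sub(1) ne(1), folded r_def])
    obtain q where q: "q \<noteq> 0" "q * xpow r \<in> K"
      "\<forall>c\<in>keys q. \<forall>i. 1 \<le> b $ i \<longrightarrow> c $ i = 0"
      by (rule m_pow_corner[OF K sub(2) ne(2), folded r_def])
    have "q * (p * xpow r) \<in> J" "p * (q * xpow r) \<in> K"
      by (rule ideals.subspace_scale[OF J p(2)], rule ideals.subspace_scale[OF K q(2)])
    then have in_m: "(p * q) * xpow r \<in> m_pow b"
      unfolding JK by (simp only: Int_iff mult.assoc mult.left_commute[of q p])
    obtain k where k: "k \<in> keys (p * q)"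
      using mpoly_mult_nonzero[OF p(1) q(1)] by (metis all_not_in_conv keys_eq_empty)
    then obtain x y where "k = x + y" "x \<in> keys p" "y \<in> keys q"
      using keys_mult[of p q] by blast
    then have "k + r \<notin> pow_up b"
      using p(3) q(3) by (force simp: pow_up_def r_def)
    moreover have "k + r \<in> pow_up b"
      using in_m k by (auto simp: m_pow_eq supported_on_def keys_mult_xpow)
    ultimately show False by contradiction
  qed
qed

section \<open>Minimal generators\<close>

text \<open>A monotone subsequence always exists; if it is decreasing, it is constant from the point where it
  takes its least value.\<close>

lemma incseq_subseq_nat:
  fixes s :: "nat \<Rightarrow> nat"
  obtains r :: "nat \<Rightarrow> nat" where "strict_mono r" "incseq (\<lambda>n. s (r n))"
proof -
  obtain r :: "nat \<Rightarrow> nat" where r: "strict_mono r" "monoseq (\<lambda>n. s (r n))"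
    using seq_monosub[of s] by blast
  show thesis
  proof (cases "incseq (\<lambda>n. s (r n))")
    case True
    then show thesis using r that by blast
  next
    case False
    then have dec: "decseq (\<lambda>n. s (r n))" using r by (simp add: monoseq_iff)
    obtain m where m: "\<And>n. s (r m) \<le> s (r n)"
      using ex_has_least_nat[of "\<lambda>_. True" 0 "\<lambda>n. s (r n)"] by blast
    have "s (r (n + m)) = s (r m)" for n
      using m[of "n + m"] decseqD[OF dec, of m "n + m"] by simp
    then have "incseq (\<lambda>n. s (r (n + m)))" by (simp add: incseq_def)
    moreover have "strict_mono (\<lambda>n. r (n + m))"
      using r(1) by (simp add: strict_mono_def)
    ultimately show thesis by (rule that[rotated])
  qed
qed

text \<open>Refining a sequence of vectors one coordinate at a time makes all coordinates weakly increasing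
  along a subsequence, so an infinite set contains two distinct comparable vectors.\<close>

lemma dickson:
  fixes A :: "(nat ^ 'n::finite) set"
  assumes antichain: "\<And>x y. x \<in> A \<Longrightarrow> y \<in> A \<Longrightarrow> x \<le> y \<Longrightarrow> x = y"
  shows "finite A"
proof (rule ccontr)
  assume "infinite A"
  then obtain f :: "nat \<Rightarrow> nat ^ 'n" where f: "inj f" "range f \<subseteq> A"
    using infinite_countable_subset by blast
  have "\<exists>r::nat \<Rightarrow> nat. strict_mono r \<and> (\<forall>i\<in>F. incseq (\<lambda>n. f (r n) $ i))"
    if "finite F" for F :: "'n set"
    using that
  proof (induction F rule: finite_induct)
    case empty
    show ?case by (rule exI[of _ "\<lambda>n. n"]) (simp add: strict_mono_def)
  next
    case (insert j F)
    then obtain r :: "nat \<Rightarrow> nat" where r: "strict_mono r" "\<forall>i\<in>F. incseq (\<lambda>n. f (r n) $ i)"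
      by blast
    obtain t :: "nat \<Rightarrow> nat" where t: "strict_mono t" "incseq (\<lambda>n. f (r (t n)) $ j)"
      by (rule incseq_subseq_nat[of "\<lambda>n. f (r n) $ j"])
    have "incseq (\<lambda>n. f (r (t n)) $ i)" if "i \<in> F" for i
      using r(2) that t(1) by (auto simp: incseq_def strict_mono_less_eq)
    then show ?case using r(1) t
      by (intro exI[of _ "\<lambda>n. r (t n)"]) (auto simp: strict_mono_def)
  qed
  from this[of UNIV] obtain r :: "nat \<Rightarrow> nat" where r: "strict_mono r"
    "\<And>i. incseq (\<lambda>n. f (r n) $ i)" by auto
  have "f (r 0) \<le> f (r 1)" using r(2) by (auto simp: less_eq_vec_def incseq_def)
  then have "f (r 0) = f (r 1)" using antichain f(2) by blast
  then show False using f(1) r(1) by (metis injD strict_mono_eq zero_neq_one)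
qed

definition minimal_elements :: "(nat ^ 'n::finite) set \<Rightarrow> (nat ^ 'n) set" where
  "minimal_elements U = {g\<in>U. \<forall>h\<in>U. h \<le> g \<longrightarrow> h = g}"

lemma finite_minimal_elements: "finite (minimal_elements U)"
  by (rule dickson) (auto simp: minimal_elements_def)

lemma up_minimal_elements:
  assumes "up_closed U"
  shows "up (minimal_elements U) = U"
proof
  show "up (minimal_elements U) \<subseteq> U"
    using assms by (auto simp: up_def up_closed_def minimal_elements_def)
  show "U \<subseteq> up (minimal_elements U)"
  proof
    fix c assume "c \<in> U"
    define w where "w c = (\<Sum>i\<in>UNIV. c $ i)" for c :: "nat ^ 'a"
    obtain g where g: "g \<in> U" "g \<le> c" and g_min: "\<And>h. h \<in> U \<Longrightarrow> h \<le> c \<Longrightarrow> w g \<le> w h"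
      using ex_has_least_nat[of "\<lambda>g. g \<in> U \<and> g \<le> c" c w] \<open>c \<in> U\<close> by blast
    have "h = g" if h: "h \<in> U" "h \<le> g" for h
    proof (rule ccontr)
      assume "h \<noteq> g"
      then obtain i where "h $ i \<noteq> g $ i" by (auto simp: vec_eq_iff)
      moreover have h_le: "h $ j \<le> g $ j" for j using h(2) by (simp add: less_eq_vec_def)
      ultimately have "h $ i < g $ i" by (simp add: le_neq_implies_less)
      then have "w h < w g"
        unfolding w_def using h_le by (intro sum_strict_mono_ex1) auto
      moreover have "w g \<le> w h" using g_min h g(2) by (meson order_trans)
      ultimately show False by simp
    qed
    then show "c \<in> up (minimal_elements U)"
      using g by (auto simp: up_def minimal_elements_def)
  qed
qed

text \<open>Every generating set of exponents of an upper set contains its minimal elements, and these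
  already generate. Hence they are the only inclusion-minimal generating set, as the definite
  description in \<open>min_gens\<close> requires.\<close>

lemma min_gens_eq:
  assumes U: "up_closed U"
  shows "min_gens (supported_on U :: ('n::finite, 'k::field) mpoly set) = minimal_elements U"
proof -
  have minimal_sub: "minimal_elements U \<subseteq> G" if "up G = U" for G
  proof
    fix g assume g: "g \<in> minimal_elements U"
    then have "g \<in> up G" using that by (simp add: minimal_elements_def)
    then obtain h where h: "h \<in> G" "h \<le> g" by (auto simp: up_def)
    have "h \<in> U" using h(1) that by (auto simp: up_def)
    then show "g \<in> G" using g h by (auto simp: minimal_elements_def)
  qed
  show ?thesis
    unfolding min_gens_def ideal_gen_xpow supported_on_eq_iff
  proof (rule the_equality, intro conjI allI impI)
    show "up (minimal_elements U) = U" by (rule up_minimal_elements[OF U])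
    show "up H \<noteq> U" if "H \<subset> minimal_elements U" for H
      using minimal_sub that by blast
    show "G = minimal_elements U" if "up G = U \<and> (\<forall>H. H \<subset> G \<longrightarrow> up H \<noteq> U)" for G
      using that minimal_sub[of G] up_minimal_elements[OF U] by blast
  qed
qed

text \<open>Finiteness of the set of minimal elements is essential here: on the natural numbers the supremum
  of an unbounded set is a default value and bounds nothing.\<close>

lemma minimal_le_lcm_exp:
  assumes "up_closed U" "g \<in> minimal_elements U"
  shows "g \<le> lcm_exp (supported_on U :: ('n::finite, 'k::field) mpoly set)"
  unfolding less_eq_vec_def
proof
  fix i
  have "g $ i \<le> (SUP c\<in>minimal_elements U. c $ i)"
    using assms(2) by (intro cSUP_upper) (simp_all add: finite_minimal_elements)
  then show "g $ i \<le> lcm_exp (supported_on U :: ('n, 'k) mpoly set) $ i"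
    by (simp add: lcm_exp_def min_gens_eq[OF assms(1)])
qed


section \<open>The irredundant irreducible decomposition\<close>

lemma finite_vec_atMost: "finite {b :: nat ^ 'n::finite. b \<le> l}"
proof (rule finite_subset)
  show "{b. b \<le> l} \<subseteq> (\<lambda>f. \<chi> i. f i) ` (\<Pi>\<^sub>E i\<in>UNIV. {..l $ i})"
  proof
    fix b assume "b \<in> {b. b \<le> l}"
    then show "b \<in> (\<lambda>f. \<chi> i. f i) ` (\<Pi>\<^sub>E i\<in>UNIV. {..l $ i})"
      by (intro image_eqI[of _ _ "\<lambda>i. b $ i"]) (auto simp: less_eq_vec_def)
  qed
  show "finite ((\<lambda>f. \<chi> i. f i) ` (\<Pi>\<^sub>E i\<in>UNIV. {..l $ i}))"
    by (intro finite_imageI finite_PiE) auto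
qed

text \<open>Every monomial \<open>x\<^sup>c\<close> outside \<open>I\<close> is excluded by one of these ideals, namely the one with
  \<open>b\<^sub>i = c\<^sub>i + 1\<close> where \<open>c\<^sub>i\<close> is below the lcm exponent and \<open>b\<^sub>i = 0\<close> elsewhere. It contains \<open>I\<close>,
  because in the coordinates with \<open>b\<^sub>i = 0\<close> no minimal generator exceeds \<open>c\<close> anyway.\<close>

lemma Inter_m_pow_above:
  fixes I :: "('n::finite, 'k::field) mpoly set"
  assumes "monomial_ideal I"
  shows "\<Inter>{m_pow b | b. b \<le> lcm_exp I \<and> I \<subseteq> m_pow b} = I"
proof
  obtain U where U: "up_closed U" "I = supported_on U"
    using assms by (auto simp: monomial_ideal_iff)
  show "\<Inter>{m_pow b | b. b \<le> lcm_exp I \<and> I \<subseteq> m_pow b} \<subseteq> I"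
  proof
    fix f :: "('n, 'k) mpoly"
    assume f: "f \<in> \<Inter>{m_pow b | b. b \<le> lcm_exp I \<and> I \<subseteq> m_pow b}"
    have "c \<in> U" if c: "c \<in> keys f" for c
    proof (rule ccontr)
      assume "c \<notin> U"
      define b :: "nat ^ 'n" where
        "b = (\<chi> i. if c $ i < lcm_exp I $ i then c $ i + 1 else 0)"
      have b_le: "b \<le> lcm_exp I" by (auto simp: b_def less_eq_vec_def)
      have "U \<subseteq> pow_up b"
      proof (rule ccontr)
        assume "\<not> U \<subseteq> pow_up b"
        then obtain d where d: "d \<in> U" "d \<notin> pow_up b" by blast
        then obtain g where g: "g \<in> minimal_elements U" "g \<le> d"
          using up_minimal_elements[OF U(1)] by (auto simp: up_def)
        have g_le: "g \<le> lcm_exp I" using minimal_le_lcm_exp[OF U(1) g(1)] U(2) by simp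
        have "g $ i \<le> c $ i" for i
        proof (cases "c $ i < lcm_exp I $ i")
          case True
          then have "d $ i < c $ i + 1"
            using d(2) by (auto simp: pow_up_def b_def not_le dest: spec[of _ i])
          moreover have "g $ i \<le> d $ i" using g(2) by (simp add: less_eq_vec_def)
          ultimately show ?thesis by linarith
        next
          case False
          moreover have "g $ i \<le> lcm_exp I $ i" using g_le by (simp add: less_eq_vec_def)
          ultimately show ?thesis by linarith
        qed
        then have "g \<le> c" by (simp add: less_eq_vec_def)
        then show False
          using \<open>c \<notin> U\<close> g(1) U(1) by (auto simp: minimal_elements_def dest: up_closedD)
      qed
      then have "f \<in> m_pow b" using f b_le by (auto simp: U(2) m_pow_eq)
      then have "c \<in> pow_up b" using c by (auto simp: m_pow_eq supported_on_def)
      then show False by (auto simp: pow_up_def b_def split: if_splits)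
    qed
    then show "f \<in> I" by (auto simp: U(2) supported_on_def)
  qed
qed auto

lemma finite_irredundant_subfamily:
  assumes "finite D"
  obtains E where "E \<subseteq> D" "\<Inter>E = \<Inter>D" "\<forall>Q\<in>E. \<Inter>(E - {Q}) \<noteq> \<Inter>D"
proof -
  obtain E where E: "E \<subseteq> D" "\<Inter>E = \<Inter>D"
    and E_min: "\<And>F. F \<subseteq> D \<and> \<Inter>F = \<Inter>D \<Longrightarrow> card E \<le> card F"
    using ex_has_least_nat[of "\<lambda>E. E \<subseteq> D \<and> \<Inter>E = \<Inter>D" D card] by blast
  have irr: "\<Inter>(E - {Q}) \<noteq> \<Inter>D" if "Q \<in> E" for Q
  proof
    assume "\<Inter>(E - {Q}) = \<Inter>D"
    moreover have "E - {Q} \<subseteq> D" using E(1) by blast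
    ultimately have "card E \<le> card (E - {Q})" using E_min by blast
    moreover have "finite E" using E(1) assms by (rule finite_subset)
    ultimately show False using that by (metis card_Diff1_less not_le)
  qed
  from E irr show thesis by (intro that[of E] ballI)
qed

text \<open>For upper sets, \<open>V \<inter> X \<subseteq> U\<close> gives \<open>U = (U \<union> V) \<inter> (U \<union> X)\<close>, so irreducibility forces
  \<open>V \<subseteq> U\<close> or \<open>X \<subseteq> U\<close>. Distributivity is what fails for general ideals, where irreducible
  components need not be unique.\<close>

lemma irreducible_contains_component:
  fixes Q :: "('n::finite, 'k::field) mpoly set"
  assumes Q: "monomial_ideal Q" "irreducible_ideal Q"
    and "finite D" "\<And>R. R \<in> D \<Longrightarrow> monomial_ideal R" "\<Inter>D \<subseteq> Q"
  obtains R where "R \<in> D" "R \<subseteq> Q"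
proof -
  obtain U where U: "up_closed U" "Q = supported_on U"
    using Q(1) by (auto simp: monomial_ideal_iff)
  have "\<exists>R\<in>D. R \<subseteq> Q" using assms(3-5)
  proof (induction D rule: finite_induct)
    case empty
    then show ?case using Q(2) by (auto simp: irreducible_ideal_def)
  next
    case (insert R D)
    obtain V where V: "up_closed V" "R = supported_on V"
      using insert.prems(1) by (auto simp: monomial_ideal_iff)
    have "\<forall>S\<in>D. \<exists>W. up_closed W \<and> S = supported_on W"
      using insert.prems(1) by (auto simp: monomial_ideal_iff)
    then obtain W where W: "\<And>S. S \<in> D \<Longrightarrow> up_closed (W S) \<and> S = supported_on (W S)"
      by metis
    define X where "X = \<Inter>(W ` D)"
    have "supported_on ` W ` D = D" using W by force
    then have X: "\<Inter>D = supported_on X" "up_closed X"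
      using W by (auto simp: X_def supported_on_Inter intro!: up_closed_Inter)
    have "V \<inter> X \<subseteq> U"
      using insert.prems(2) by (simp add: V(2) X(1) U(2) supported_on_Int[symmetric])
    then have "Q = supported_on (U \<union> V) \<inter> supported_on (U \<union> X)"
      by (auto simp: U(2) supported_on_Int[symmetric] simp del: Un_Int_distrib)
    moreover have "is_ideal (supported_on (U \<union> V) :: ('n, 'k) mpoly set)"
      "is_ideal (supported_on (U \<union> X) :: ('n, 'k) mpoly set)"
      using U(1) V(1) X(2) by (auto intro!: is_ideal_supported_on up_closed_Un)
    ultimately have "Q = supported_on (U \<union> V) \<or> Q = supported_on (U \<union> X)"
      using Q(2) unfolding irreducible_ideal_def by blast
    then have "R \<subseteq> Q \<or> \<Inter>D \<subseteq> Q"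
      by (auto simp: U(2) V(2) X(1))
    then show ?case using insert.IH insert.prems(1) by auto
  qed
  then show thesis using that by blast
qed

text \<open>Each component of one decomposition contains a component of the other, which in turn contains a
  component of the first; irredundancy makes the two ends of this chain equal.\<close>

lemma irredundant_decomp_unique:
  fixes I :: "('n::finite, 'k::field) mpoly set"
  assumes D: "irredundant_decomp D I" and E: "irredundant_decomp E I"
  shows "D = E"
proof -
  have sub: "D \<subseteq> E" if D: "irredundant_decomp D I" and E: "irredundant_decomp E I" for D E
  proof
    fix Q assume Q: "Q \<in> D"
    then have "\<Inter>E \<subseteq> Q" using D E by (auto simp: irredundant_decomp_def)
    then obtain R where R: "R \<in> E" "R \<subseteq> Q"
      using irreducible_contains_component[of Q E] Q D E by (auto simp: irredundant_decomp_def)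
    then have "\<Inter>D \<subseteq> R" using D E by (auto simp: irredundant_decomp_def)
    then obtain Q' where Q': "Q' \<in> D" "Q' \<subseteq> R"
      using irreducible_contains_component[of R D] R D E by (auto simp: irredundant_decomp_def)
    have "Q' = Q"
    proof (rule ccontr)
      assume "Q' \<noteq> Q"
      then have "\<Inter>(D - {Q}) = \<Inter>D" using Q' R by blast
      then show False using D Q by (auto simp: irredundant_decomp_def)
    qed
    then show "Q \<in> E" using Q' R by auto
  qed
  show ?thesis using sub[OF D E] sub[OF E D] by blast
qed

lemma Irr_m_pow:
  fixes I :: "('n::finite, 'k::field) mpoly set"
  assumes "monomial_ideal I"
  shows "\<Inter>(Irr I) = I" "Irr I \<subseteq> {m_pow b | b. b \<le> lcm_exp I}"
proof -
  let ?D = "{m_pow b :: ('n, 'k) mpoly set | b. b \<le> lcm_exp I \<and> I \<subseteq> m_pow b}"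
  have "finite (m_pow ` {b. b \<le> lcm_exp I} :: ('n, 'k) mpoly set set)"
    by (rule finite_imageI[OF finite_vec_atMost])
  then have fin: "finite ?D" by (rule finite_subset[rotated]) auto
  then obtain E where E: "E \<subseteq> ?D" "\<Inter>E = I" "\<forall>Q\<in>E. \<Inter>(E - {Q}) \<noteq> I"
    by (rule finite_irredundant_subfamily[of ?D, unfolded Inter_m_pow_above[OF assms]])
  have "monomial_ideal Q \<and> irreducible_ideal Q" if Q: "Q \<in> E" for Q
  proof -
    obtain b where "Q = m_pow b" using E(1) Q by auto
    then show ?thesis
      using irreducible_m_pow[of b] up_closed_pow_up[of b]
      unfolding monomial_ideal_iff m_pow_eq by blast
  qed
  then have "irredundant_decomp E I"
    using E finite_subset[OF E(1) fin] by (auto simp: irredundant_decomp_def)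
  then have "Irr I = E"
    unfolding Irr_def by (intro the_equality irredundant_decomp_unique[of _ I])
  with E(1,2) show "\<Inter>(Irr I) = I" "Irr I \<subseteq> {m_pow b | b. b \<le> lcm_exp I}"
    by (simp, blast)
qed


section \<open>The colon ideal\<close>

lemma colon_ideal_gen:
  assumes "is_ideal A"
  shows "colon A (ideal_gen X) = {f. \<forall>x\<in>X. f * x \<in> A}"
proof
  show "colon A (ideal_gen X) \<subseteq> {f. \<forall>x\<in>X. f * x \<in> A}"
    by (auto simp: colon_def ideals.span_base)
  show "{f. \<forall>x\<in>X. f * x \<in> A} \<subseteq> colon A (ideal_gen X)"
  proof
    fix f assume f: "f \<in> {f. \<forall>x\<in>X. f * x \<in> A}"
    have "is_ideal {g. f * g \<in> A}"
    proof (rule ideals.subspaceI)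
      show "0 \<in> {g. f * g \<in> A}" using ideals.subspace_0[OF assms] by simp
      show "x + y \<in> {g. f * g \<in> A}" if "x \<in> {g. f * g \<in> A}" "y \<in> {g. f * g \<in> A}" for x y
        using ideals.subspace_add[OF assms, of "f * x" "f * y"] that by (simp add: distrib_left)
      show "c * x \<in> {g. f * g \<in> A}" if "x \<in> {g. f * g \<in> A}" for c x
        using ideals.subspace_scale[OF assms, of "f * x" c] that by (simp add: mult.left_commute)
    qed
    then have "ideal_gen X \<subseteq> {g. f * g \<in> A}"
      using f by (intro ideals.span_minimal) blast+
    then show "f \<in> colon A (ideal_gen X)" by (auto simp: colon_def)
  qed
qed

text \<open>The exponent \<open>dual_exp a b\<close> is chosen so that adding it turns the threshold \<open>b\<^sub>i\<close> into
  \<open>a\<^sub>i + 1\<close>. The hypothesis keeps the subtraction \<open>a\<^sub>i + 1 - b\<^sub>i\<close> from truncating.\<close>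

lemma add_dual_exp_in_pow_up_iff:
  assumes "b \<le> a"
  shows "c + dual_exp a b \<in> pow_up (a + 1) \<longleftrightarrow> c \<in> pow_up b \<union> pow_up (a + 1)"
proof -
  have le: "b $ i \<le> a $ i" for i using assms by (simp add: less_eq_vec_def)
  have "a $ i + 1 \<le> c $ i + dual_exp a b $ i \<longleftrightarrow>
      (1 \<le> b $ i \<and> b $ i \<le> c $ i) \<or> a $ i + 1 \<le> c $ i" for i
    using le[of i] by (auto simp: dual_exp_def)
  then show ?thesis by (auto simp: pow_up_def)
qed

theorem theorem2p1:
  fixes I :: "('n::finite, 'k::field) mpoly set" and a :: "nat ^ 'n"
  assumes "CARD('n) \<ge> 2"
    and "monomial_ideal I" and "I \<noteq> UNIV"
    and "lcm_exp I \<le> a"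
  shows "colon (m_pow (a + 1)) (alexander_dual a I) = I + m_pow (a + 1)"
proof -
  let ?M = "m_pow (a + 1) :: ('n, 'k) mpoly set"
  define E where "E = {b. (m_pow b :: ('n, 'k) mpoly set) \<in> Irr I}"
  have E_le: "b \<le> a" if "b \<in> E" for b
  proof -
    have "\<exists>b'. (m_pow b :: ('n, 'k) mpoly set) = m_pow b' \<and> b' \<le> lcm_exp I"
      using that Irr_m_pow(2)[OF assms(2)] by (auto simp: E_def)
    then show ?thesis using assms(4) by (auto simp: m_pow_inject)
  qed
  have "Irr I = m_pow ` E"
    using Irr_m_pow(2)[OF assms(2)] by (auto simp: E_def)
  then have I: "I = supported_on (\<Inter>(pow_up ` E))"
    using Irr_m_pow(1)[OF assms(2)]
    by (simp add: supported_on_Inter image_image m_pow_eq)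
  have M: "is_ideal ?M"
    by (simp add: m_pow_eq is_ideal_supported_on up_closed_pow_up)
  have "f \<in> colon ?M (alexander_dual a I) \<longleftrightarrow> f \<in> supported_on (\<Inter>(pow_up ` E) \<union> pow_up (a + 1))"
    for f :: "('n, 'k) mpoly"
  proof -
    have "f \<in> colon ?M (alexander_dual a I) \<longleftrightarrow> (\<forall>b\<in>E. f * xpow (dual_exp a b) \<in> ?M)"
      unfolding alexander_dual_def colon_ideal_gen[OF M] by (auto simp: E_def)
    also have "\<dots> \<longleftrightarrow> (\<forall>b\<in>E. \<forall>c\<in>keys f. c + dual_exp a b \<in> pow_up (a + 1))"
      by (auto simp: m_pow_eq supported_on_def keys_mult_xpow)
    also have "\<dots> \<longleftrightarrow> (\<forall>b\<in>E. \<forall>c\<in>keys f. c \<in> pow_up b \<union> pow_up (a + 1))"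
      using E_le by (simp add: add_dual_exp_in_pow_up_iff)
    also have "\<dots> \<longleftrightarrow> f \<in> supported_on (\<Inter>(pow_up ` E) \<union> pow_up (a + 1))"
      by (auto simp: supported_on_def)
    finally show ?thesis .
  qed
  then have "colon ?M (alexander_dual a I) = supported_on (\<Inter>(pow_up ` E) \<union> pow_up (a + 1))"
    by blast
  also have "\<dots> = I + ?M"
    unfolding I m_pow_eq
    by (intro supported_on_Un up_closed_Inter) (auto intro: up_closed_pow_up)
  finally show ?thesis .
qed

end
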